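(* Let $R \subset \mathbb{H}^d$ be a reduced body in the $d$-dimensional hyperbolic space and let $e$ be an extreme point of $R$. Then there exists a supporting hyperplane $H$ of $R$ such that $H$ or $E_H(R)$ supports $R$ at $e$ (that is, $e \in H$ or $e \in E_H(R)$), and the thickness of the equidistant strip $\mathrm{conv}(H \cup E_H(R))$ is $\Delta(R)$.
   Context: $\mathbb{H}^d$ is the $d$-dimensional hyperbolic space. A convex body is a compact convex set with non-empty interior; $\mathrm{conv}$ denotes the (hyperbolic) convex hull. Hyperplanes are $(d-1)$-dimensional totally geodesic subspaces. Width and thickness of a body: for a hyperplane $H$ supporting a convex body $C \subset \mathbb{H}^d$, the width of $C$ determined by $H$, denoted $\mathrm{width}_H(C)$, is the distance between $H$ and any farthest hyperplane supporting $C$ that is ultraparallel to $H$. The thickness $\Delta(C)$ is the infimum (in fact the minimum) of $\mathrm{width}_H(C)$ over all hyperplanes $H$ supporting $C$. Reduced body: a convex body $R \subset \mathbb{H}^d$ is called reduced if $\Delta(Z) < \Delta(R)$ for every convex body $Z$ properly contained in $R$. Equidistant surfaces and strips: an equidistant surface to a hyperplane $H$ is the set of all points lying at a fixed positive distance from $H$ in one of the half-spaces bounded by $H$. The equidistant strip generated by $H$ and an equidistant surface $E$ to it is $\mathrm{conv}(H \cup E)$; its thickness is the distance between $H$ and $E$. For a convex body $C$ and a supporting hyperplane $H$ of $C$, $E_H(C)$ denotes the unique nearest equidistant surface to $H$ such that $C \subset \mathrm{conv}(H \cup E_H(C))$; one says that $E_H(C)$ supports $C$, and that it supports $C$ at a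 point $e \in C$ if it passes through $e$. *)

theory Defs
  imports "HOL-Analysis.Analysis"
begin

(* The d-dimensional hyperbolic space is taken in the Beltrami-Klein (projective) model:
   the open unit ball of a Euclidean space 'a with DIM('a) = d.  Geodesic segments are
   Euclidean segments and totally geodesic subspaces are the traces of affine subspaces,
   so hyperbolic convexity, convex hulls and extreme points are the Euclidean ones.  The
   hyperbolic metric induces the Euclidean topology on the ball, so compactness and
   interiors also agree.  Only metric quantities differ from their Euclidean counterparts. *)

definition hyp_space :: "'a::euclidean_space set" where
  "hyp_space = ball 0 1"

(* The Cayley-Klein metric of curvature -1. *)
definition hyp_dist :: "'a::euclidean_space \<Rightarrow> 'a \<Rightarrow> real" where
  "hyp_dist x y = arcosh ((1 - x \<bullet> y) / sqrt ((1 - x \<bullet> x) * (1 - y \<bullet> y)))"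

definition hyp_setdist :: "'a::euclidean_space set \<Rightarrow> 'a set \<Rightarrow> real" where
  "hyp_setdist A B = (INF (x, y) \<in> A \<times> B. hyp_dist x y)"

(* An affine hyperplane that meets the open ball has a (d-1)-dimensional trace in it. *)
definition hyp_hyperplane :: "'a::euclidean_space set \<Rightarrow> bool" where
  "hyp_hyperplane H \<longleftrightarrow> H \<noteq> {} \<and> (\<exists>a b. a \<noteq> 0 \<and> H = {x \<in> hyp_space. a \<bullet> x = b})"

(* K is a closed half-space bounded by H; replacing (a, b) by (-a, -b) gives the other one. *)
definition hyp_halfspace :: "'a::euclidean_space set \<Rightarrow> 'a set \<Rightarrow> bool" where
  "hyp_halfspace H K \<longleftrightarrow> H \<noteq> {} \<and>
     (\<exists>a b. a \<noteq> 0 \<and> H = {x \<in> hyp_space. a \<bullet> x = b} \<and> K = {x \<in> hyp_space. a \<bullet> x \<le> b})"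

(* The Euclidean closure adds to a hyperplane its ideal points on the unit sphere, so
   disjoint closures mean: no common point and no common ideal point. *)
definition ultraparallel :: "'a::euclidean_space set \<Rightarrow> 'a set \<Rightarrow> bool" where
  "ultraparallel H G \<longleftrightarrow>
     hyp_hyperplane H \<and> hyp_hyperplane G \<and> closure H \<inter> closure G = {}"

definition convex_body :: "'a::euclidean_space set \<Rightarrow> bool" where
  "convex_body C \<longleftrightarrow> C \<subseteq> hyp_space \<and> compact C \<and> convex C \<and> interior C \<noteq> {}"

definition supporting_hyperplane :: "'a::euclidean_space set \<Rightarrow> 'a set \<Rightarrow> bool" where
  "supporting_hyperplane H C \<longleftrightarrow>
     hyp_hyperplane H \<and> (\<exists>K. hyp_halfspace H K \<and> C \<subseteq> K) \<and> H \<inter> C \<noteq> {}"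

(* For a convex body C and a supporting H the supremum is attained, by the hyperplane
   through a point of C farthest from H, orthogonal to the perpendicular from it to H. *)
definition width :: "'a::euclidean_space set \<Rightarrow> 'a set \<Rightarrow> real" where
  "width H C = (SUP G \<in> {G. supporting_hyperplane G C \<and> ultraparallel H G}. hyp_setdist H G)"

definition thickness :: "'a::euclidean_space set \<Rightarrow> real" where
  "thickness C = (INF H \<in> {H. supporting_hyperplane H C}. width H C)"

definition reduced_body :: "'a::euclidean_space set \<Rightarrow> bool" where
  "reduced_body R \<longleftrightarrow>
     convex_body R \<and> (\<forall>Z. convex_body Z \<and> Z \<subset> R \<longrightarrow> thickness Z < thickness R)"

definition equidistant_surface :: "'a::euclidean_space set \<Rightarrow> 'a set \<Rightarrow> bool" where
  "equidistant_surface H E \<longleftrightarrow> hyp_hyperplane H \<and>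
     (\<exists>K r. hyp_halfspace H K \<and> r > 0 \<and> E = {x \<in> K. hyp_setdist {x} H = r})"

definition equidistant_strip :: "'a::euclidean_space set \<Rightarrow> 'a set \<Rightarrow> 'a set" where
  "equidistant_strip H E = convex hull (H \<union> E)"

(* Thickness of the strip equidistant_strip H E, as a function of its generators. *)
definition strip_thickness :: "'a::euclidean_space set \<Rightarrow> 'a set \<Rightarrow> real" where
  "strip_thickness H E = hyp_setdist H E"

(* E_H(C).  Existence and uniqueness hold whenever C is a convex body supported by H:
   since C has interior points, it determines the side of H on which E lies. *)
definition nearest_equidistant :: "'a::euclidean_space set \<Rightarrow> 'a set \<Rightarrow> 'a set" where
  "nearest_equidistant H C =
     (THE E. equidistant_surface H E \<and> C \<subseteq> equidistant_strip H E \<and>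
        (\<forall>E'. equidistant_surface H E' \<and> C \<subseteq> equidistant_strip H E' \<longrightarrow>
              hyp_setdist H E \<le> hyp_setdist H E'))"

end

theory Submission
  imports Defs
begin

text \<open>In the Klein model, \<open>sinh_height a b\<close> is the hyperbolic sine of the signed distance to
  the hyperplane \<open>a \<bullet> x = b\<close> (for \<open>norm a = 1\<close>).  The strips
  \<open>0 \<le> sinh_height a b x \<le> s\<close> are convex, and the tangent hyperplane to a level set is
  ultraparallel to the base hyperplane, so both the width of a body and the thickness of its
  nearest equidistant strip are given by the maximum of this function on the body.

  Let \<open>e\<close> be an extreme point of the reduced body \<open>R\<close>.  Cutting a ball of radius
  \<open>\<rho>\<close> around \<open>e\<close> out of \<open>R\<close> and taking the convex hull gives a proper subbody, which
  therefore lies in a strip thinner than \<open>thickness R\<close>.  This strip cannot contain \<open>R\<close>, so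
  some point of \<open>R\<close> within \<open>\<rho>\<close> of \<open>e\<close> violates one of its two inequalities.  As
  \<open>\<rho>\<close> tends to 0, a subsequence of these strips converges to a strip of thickness
  \<open>thickness R\<close> containing \<open>R\<close>, with \<open>e\<close> on its boundary.\<close>

subsection \<open>Distance to a hyperplane in the Klein model\<close>

abbreviation hplane :: "'a::euclidean_space \<Rightarrow> real \<Rightarrow> 'a set" where
  "hplane a b \<equiv> {x \<in> hyp_space. a \<bullet> x = b}"

abbreviation hside :: "'a::euclidean_space \<Rightarrow> real \<Rightarrow> 'a set" where
  "hside a b \<equiv> {x \<in> hyp_space. a \<bullet> x \<le> b}"

text \<open>In the hyperboloid model with unit \<open>a\<close>, this is the Lorentz product of
  \<open>(b, a)\<close> and \<open>(1, x)\<close>, each scaled to unit length. The sign makes it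
  positive on the side \<open>a \<bullet> x < b\<close>.\<close>

definition sinh_height :: "'a::euclidean_space \<Rightarrow> real \<Rightarrow> 'a \<Rightarrow> real" where
  "sinh_height a b x = (b - a \<bullet> x) / (sqrt (1 - b\<^sup>2) * sqrt (1 - x \<bullet> x))"

section \<open>Inequalities behind the Klein metric\<close>

lemma hyp_space_iff: "x \<in> hyp_space \<longleftrightarrow> x \<bullet> x < 1"
  unfolding hyp_space_def by (auto simp: norm_eq_sqrt_inner)

lemma hyp_space_norm: "x \<in> hyp_space \<longleftrightarrow> norm x < 1"
  unfolding hyp_space_def by auto

lemma inner_less_one:
  assumes "norm x < 1" "norm y \<le> 1"
  shows "x \<bullet> y < 1"
proof -
  have "x \<bullet> y \<le> norm x * norm y" by (rule norm_cauchy_schwarz)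
  also have "\<dots> \<le> norm x * 1" using assms by (intro mult_left_mono) auto
  finally show ?thesis using assms by simp
qed

text \<open>The Cauchy-Schwarz inequality for timelike vectors \<open>(t, v)\<close> and
  \<open>(1, y)\<close>. Once \<open>v \<bullet> y\<close> is replaced by the product of the norms,
  it follows from a two-dimensional identity whose error term is a square.\<close>

lemma reversed_Cauchy_Schwarz:
  fixes v y :: "'a::real_inner"
  assumes "norm v \<le> t" "norm y \<le> 1"
  shows "sqrt (t\<^sup>2 - v \<bullet> v) * sqrt (1 - y \<bullet> y) \<le> t - v \<bullet> y"
proof -
  have "t \<ge> 0" using assms(1) norm_ge_zero order_trans by blast
  have vy: "v \<bullet> y \<le> norm v * norm y" by (rule norm_cauchy_schwarz)
  have "norm v * norm y \<le> t * 1"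
    using assms \<open>t \<ge> 0\<close> by (intro mult_mono) auto
  then have nn: "0 \<le> t - norm v * norm y" by simp
  have "(t\<^sup>2 - v \<bullet> v) * (1 - y \<bullet> y) = (t - norm v * norm y)\<^sup>2 - (t * norm y - norm v)\<^sup>2"
    unfolding power2_norm_eq_inner[symmetric] by (simp add: power2_eq_square algebra_simps)
  also have "\<dots> \<le> (t - norm v * norm y)\<^sup>2" by simp
  finally have "sqrt ((t\<^sup>2 - v \<bullet> v) * (1 - y \<bullet> y)) \<le> t - norm v * norm y"
    using nn by (metis real_sqrt_le_mono real_sqrt_unique)
  then show ?thesis using vy by (simp add: real_sqrt_mult)
qed

lemma sqrt_mult_le_one_minus_inner:
  assumes "x \<in> hyp_space" "y \<in> hyp_space"
  shows "sqrt (1 - x \<bullet> x) * sqrt (1 - y \<bullet> y) \<le> 1 - x \<bullet> y"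
  using reversed_Cauchy_Schwarz[of x 1 y] assms by (simp add: hyp_space_norm)

text \<open>The graph of the concave function \<open>sqrt (1 - x \<bullet> x)\<close> lies below its
  tangent hyperplane at \<open>c\<close>: the right-hand side is affine in \<open>x\<close> and
  agrees with the left at \<open>x = c\<close>. Both the convexity of strips and the construction of
  tangent hyperplanes rest on this.\<close>

lemma sqrt_tangent:
  assumes "c \<in> hyp_space" "x \<in> hyp_space"
  shows "sqrt (1 - x \<bullet> x) \<le> (1 - c \<bullet> x) / sqrt (1 - c \<bullet> c)"
  using sqrt_mult_le_one_minus_inner[OF assms] assms
  by (simp add: hyp_space_iff le_divide_eq mult.commute)

lemma hyp_dist_eq:
  "hyp_dist x y = arcosh ((1 - x \<bullet> y) / (sqrt (1 - x \<bullet> x) * sqrt (1 - y \<bullet> y)))"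
  by (simp add: hyp_dist_def real_sqrt_mult)

lemma hyp_dist_commute: "hyp_dist x y = hyp_dist y x"
  by (simp add: hyp_dist_def inner_commute mult.commute)

lemma hyp_dist_nonneg:
  assumes "x \<in> hyp_space" "y \<in> hyp_space"
  shows "hyp_dist x y \<ge> 0"
proof -
  have "sqrt (1 - x \<bullet> x) * sqrt (1 - y \<bullet> y) > 0"
    using assms by (simp add: hyp_space_iff)
  then show ?thesis
    unfolding hyp_dist_eq using sqrt_mult_le_one_minus_inner[OF assms]
    by (intro arcosh_nonneg_real) (simp add: le_divide_eq)
qed

lemma hyp_setdist_le:
  assumes "A \<subseteq> hyp_space" "B \<subseteq> hyp_space" "x \<in> A" "y \<in> B"
  shows "hyp_setdist A B \<le> hyp_dist x y"
proof -
  have "bdd_below ((\<lambda>(x, y). hyp_dist x y) ` (A \<times> B))"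
    using assms by (intro bdd_belowI[of _ 0]) (auto intro!: hyp_dist_nonneg)
  then show ?thesis
    unfolding hyp_setdist_def using assms by (intro cINF_lower2[of _ _ "(x, y)"]) auto
qed

lemma hyp_setdist_ge:
  assumes "A \<noteq> {}" "B \<noteq> {}" "\<And>x y. x \<in> A \<Longrightarrow> y \<in> B \<Longrightarrow> r \<le> hyp_dist x y"
  shows "r \<le> hyp_setdist A B"
  unfolding hyp_setdist_def using assms by (intro cINF_greatest) auto

lemma arcosh_sqrt_eq_arsinh: "arcosh (sqrt (1 + u\<^sup>2)) = arsinh \<bar>u\<bar>" for u :: real
proof -
  have "arsinh \<bar>u\<bar> \<ge> 0" by (metis abs_ge_zero arsinh_real_neg_iff not_le)
  then show ?thesis
    by (metis arcosh_cosh_real cosh_arsinh_real power2_abs add.commute)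
qed

lemma arsinh_le_iff_real: "arsinh x \<le> arsinh y \<longleftrightarrow> x \<le> (y::real)"
  by (meson arsinh_less_iff_real not_le)

lemma arcosh_le_real:
  assumes "1 \<le> x" "x \<le> (y::real)"
  shows "arcosh x \<le> arcosh y"
  using assms by (cases "x = y") (auto intro: less_imp_le)

section \<open>Signed height over a fixed hyperplane\<close>

context
  fixes a :: "'a::euclidean_space" and b :: real
  assumes a: "norm a = 1" and b: "\<bar>b\<bar> < 1"
begin

lemma inner_normal [simp]: "a \<bullet> a = 1"
  using a by (simp add: norm_eq_1)

lemma offset_square_less_one [simp]: "b\<^sup>2 < 1"
  using b by (simp add: abs_square_less_1)

lemma one_minus_offset_pos: "1 - b\<^sup>2 > 0"
  by simp

lemma foot_in_hplane: "b *\<^sub>R a \<in> hplane a b"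
  using a b by (simp add: hyp_space_norm)

lemma sinh_height_denominator_pos:
  "x \<in> hyp_space \<Longrightarrow> sqrt (1 - b\<^sup>2) * sqrt (1 - x \<bullet> x) > 0"
  by (simp add: hyp_space_iff)

lemma sinh_height_le_iff:
  "x \<in> hyp_space \<Longrightarrow>
    sinh_height a b x \<le> s \<longleftrightarrow> b - a \<bullet> x \<le> s * (sqrt (1 - b\<^sup>2) * sqrt (1 - x \<bullet> x))"
  unfolding sinh_height_def using sinh_height_denominator_pos[of x] by (simp add: divide_le_eq)

lemma sinh_height_ge_iff:
  "x \<in> hyp_space \<Longrightarrow>
    s \<le> sinh_height a b x \<longleftrightarrow> s * (sqrt (1 - b\<^sup>2) * sqrt (1 - x \<bullet> x)) \<le> b - a \<bullet> x"
  unfolding sinh_height_def using sinh_height_denominator_pos[of x] by (simp add: le_divide_eq)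

lemma sinh_height_nonneg_iff:
  "x \<in> hyp_space \<Longrightarrow> 0 \<le> sinh_height a b x \<longleftrightarrow> a \<bullet> x \<le> b"
  using sinh_height_ge_iff[of x 0] by simp

lemma sinh_height_pos_iff:
  "x \<in> hyp_space \<Longrightarrow> 0 < sinh_height a b x \<longleftrightarrow> a \<bullet> x < b"
  using sinh_height_le_iff[of x 0] by (simp add: not_le[symmetric])

lemma sinh_height_eq_iff:
  "x \<in> hyp_space \<Longrightarrow>
    sinh_height a b x = s \<longleftrightarrow> b - a \<bullet> x = s * (sqrt (1 - b\<^sup>2) * sqrt (1 - x \<bullet> x))"
  by (simp add: order_eq_iff sinh_height_le_iff sinh_height_ge_iff)

text \<open>In the hyperboloid model \<open>(t, v)\<close> below is the Lorentz-orthogonal projection of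
  \<open>(1, x)\<close> onto the hyperplane with normal \<open>(b, a)\<close>; it has Lorentz norm
  \<open>t\<^sup>2 - v \<bullet> v\<close>, and \<open>v / t\<close> is the foot of the perpendicular in the Klein model.\<close>

lemma hyp_dist_hplane:
  assumes x: "x \<in> hyp_space"
  shows "\<And>y. y \<in> hplane a b \<Longrightarrow> arsinh \<bar>sinh_height a b x\<bar> \<le> hyp_dist x y"
    and "\<exists>y \<in> hplane a b. hyp_dist x y = arsinh \<bar>sinh_height a b x\<bar>"
proof -
  define m where "m = (a \<bullet> x - b) / (1 - b\<^sup>2)"
  define t where "t = 1 - m * b"
  define v where "v = x - m *\<^sub>R a"
  define k where "k = sqrt (1 - x \<bullet> x)"
  define h where "h = sinh_height a b x"
  have k: "k > 0" "k\<^sup>2 = 1 - x \<bullet> x"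
    using x by (simp_all add: k_def hyp_space_iff)
  have m: "m * (1 - b\<^sup>2) = a \<bullet> x - b"
    unfolding m_def using one_minus_offset_pos by (metis less_irrefl nonzero_eq_divide_eq)
  have sb: "(sqrt (1 - b\<^sup>2))\<^sup>2 = 1 - b\<^sup>2"
    using one_minus_offset_pos by (simp add: less_imp_le)
  have h2: "h\<^sup>2 * k\<^sup>2 = m\<^sup>2 * (1 - b\<^sup>2)"
  proof -
    have "h\<^sup>2 = (b - a \<bullet> x)\<^sup>2 / ((1 - b\<^sup>2) * k\<^sup>2)"
      unfolding h_def sinh_height_def k_def[symmetric] power_divide power_mult_distrib sb ..
    then have "h\<^sup>2 * k\<^sup>2 = (b - a \<bullet> x)\<^sup>2 / (1 - b\<^sup>2)"
      using k(1) by simp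
    also have "(b - a \<bullet> x)\<^sup>2 = (m * (1 - b\<^sup>2))\<^sup>2"
      unfolding m by (simp add: power2_commute)
    also have "\<dots> / (1 - b\<^sup>2) = m\<^sup>2 * (1 - b\<^sup>2)"
      using one_minus_offset_pos by (simp add: power2_eq_square)
    finally show ?thesis .
  qed
  have tv: "t\<^sup>2 - v \<bullet> v = k\<^sup>2 * (1 + h\<^sup>2)"
  proof -
    have "t\<^sup>2 - v \<bullet> v = 1 - x \<bullet> x + 2 * m * (a \<bullet> x - b) - m\<^sup>2 * (1 - b\<^sup>2)"
      unfolding t_def v_def
      by (simp add: inner_diff_left inner_diff_right inner_commute power2_eq_square algebra_simps)
    also have "\<dots> = 1 - x \<bullet> x + m\<^sup>2 * (1 - b\<^sup>2)"
      unfolding m[symmetric] by (simp add: power2_eq_square)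
    also have "\<dots> = k\<^sup>2 + h\<^sup>2 * k\<^sup>2" using h2 k by simp
    finally show ?thesis by (simp add: algebra_simps)
  qed
  have pos: "k\<^sup>2 * (1 + h\<^sup>2) > 0" using k(1) by (simp add: add_pos_nonneg)
  \<comment> \<open>\<open>(1, y)\<close> is Lorentz-orthogonal to the normal \<open>(b, a)\<close>,
    so its product with \<open>(1, x)\<close> sees only the projection
    \<open>(t, v)\<close>.\<close>
  have ty: "t - v \<bullet> y = 1 - x \<bullet> y" if "a \<bullet> y = b" for y
    unfolding t_def v_def using that by (simp add: inner_diff_left)
  have av: "a \<bullet> v = b * t"
    using m unfolding v_def t_def by (simp add: inner_diff_right power2_eq_square algebra_simps)
  have nvt: "norm v < \<bar>t\<bar>"
    using tv pos by (simp add: norm_lt_square[symmetric] abs_le_square_iff norm_eq_sqrt_inner real_less_lsqrt)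
  \<comment> \<open>The norm identity bounds \<open>norm v\<close> by the absolute value of
    \<open>t\<close> only. The sign comes from pairing with the point \<open>b *\<^sub>R a\<close>
    of the hyperplane, where the product is positive.\<close>
  have t: "t > 0"
  proof (rule ccontr)
    assume "\<not> t > 0"
    have p: "a \<bullet> (b *\<^sub>R a) = b" by simp
    have "norm (b *\<^sub>R a) < 1" using a b by simp
    moreover have "norm x < 1" using x by (simp add: hyp_space_norm)
    ultimately have "1 - x \<bullet> (b *\<^sub>R a) > 0" using inner_less_one[of x "b *\<^sub>R a"] by simp
    then have "t > v \<bullet> (b *\<^sub>R a)" using ty[OF p] by simp
    moreover have "\<bar>v \<bullet> (b *\<^sub>R a)\<bar> \<le> norm v * norm (b *\<^sub>R a)" by (rule Cauchy_Schwarz_ineq2)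
    moreover have "norm v * norm (b *\<^sub>R a) \<le> norm v * 1"
      using \<open>norm (b *\<^sub>R a) < 1\<close> by (intro mult_left_mono) auto
    ultimately show False using nvt \<open>\<not> t > 0\<close> by linarith
  qed
  have sq: "sqrt (t\<^sup>2 - v \<bullet> v) = k * sqrt (1 + h\<^sup>2)"
    unfolding tv using k(1) by (simp add: real_sqrt_mult)
  have ars: "arsinh \<bar>sinh_height a b x\<bar> = arcosh (sqrt (1 + h\<^sup>2))"
    by (simp add: arcosh_sqrt_eq_arsinh h_def)
  show "arsinh \<bar>sinh_height a b x\<bar> \<le> hyp_dist x y" if y: "y \<in> hplane a b" for y
  proof -
    have yk: "sqrt (1 - y \<bullet> y) > 0" using y by (simp add: hyp_space_iff)
    have "k * sqrt (1 + h\<^sup>2) * sqrt (1 - y \<bullet> y) \<le> 1 - x \<bullet> y"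
      using reversed_Cauchy_Schwarz[of v t y] nvt t y ty[of y] sq by (simp add: hyp_space_norm)
    then have "sqrt (1 + h\<^sup>2) \<le> (1 - x \<bullet> y) / (k * sqrt (1 - y \<bullet> y))"
      using k(1) yk by (simp add: le_divide_eq mult.commute mult.left_commute)
    then show ?thesis
      unfolding ars hyp_dist_eq k_def[symmetric] by (intro arcosh_le_real) auto
  qed
  define y where "y = (1 / t) *\<^sub>R v"
  have "norm y < 1" unfolding y_def using t nvt by simp
  have ay: "a \<bullet> y = b" unfolding y_def using av t by simp
  then have yH: "y \<in> hplane a b" using \<open>norm y < 1\<close> by (simp add: hyp_space_norm)
  have "1 - y \<bullet> y = (t\<^sup>2 - v \<bullet> v) / t\<^sup>2"
    unfolding y_def using t by (simp add: field_simps power2_eq_square)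
  then have yk: "sqrt (1 - y \<bullet> y) = k * sqrt (1 + h\<^sup>2) / t"
    using t sq by (simp add: real_sqrt_divide)
  have "t - v \<bullet> y = (t\<^sup>2 - v \<bullet> v) / t"
    unfolding y_def using t by (simp add: field_simps power2_eq_square)
  then have xy: "1 - x \<bullet> y = k\<^sup>2 * (1 + h\<^sup>2) / t" by (simp add: tv ty[OF ay])
  define w where "w = sqrt (1 + h\<^sup>2)"
  have w: "w > 0" "1 + h\<^sup>2 = w\<^sup>2" by (simp_all add: w_def add_pos_nonneg)
  have "(1 - x \<bullet> y) / (k * sqrt (1 - y \<bullet> y)) = w"
    unfolding xy yk w_def[symmetric] w(2) using k(1) t w(1) by (simp add: field_simps power2_eq_square)
  then have "hyp_dist x y = arsinh \<bar>sinh_height a b x\<bar>"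
    unfolding ars hyp_dist_eq k_def[symmetric] w_def by simp
  then show "\<exists>y \<in> hplane a b. hyp_dist x y = arsinh \<bar>sinh_height a b x\<bar>"
    using yH by blast
qed

lemma hyp_setdist_point_hplane:
  assumes "x \<in> hyp_space"
  shows "hyp_setdist {x} (hplane a b) = arsinh \<bar>sinh_height a b x\<bar>"
proof (rule antisym)
  obtain y where "y \<in> hplane a b" "hyp_dist x y = arsinh \<bar>sinh_height a b x\<bar>"
    using hyp_dist_hplane(2)[OF assms] by blast
  then show "hyp_setdist {x} (hplane a b) \<le> arsinh \<bar>sinh_height a b x\<bar>"
    using hyp_setdist_le[of "{x}" "hplane a b" x y] assms by auto
  show "arsinh \<bar>sinh_height a b x\<bar> \<le> hyp_setdist {x} (hplane a b)"
    using foot_in_hplane hyp_dist_hplane(1)[OF assms] by (intro hyp_setdist_ge) auto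
qed

text \<open>On this side the height is nonnegative, so the absolute value in the distance formula
  disappears. Using the hyperbolic sine of the distance as parameter turns equidistant surfaces into
  level sets of an algebraic function.\<close>

lemma level_set_eq_equidistant:
  assumes "s > 0"
  shows "{x \<in> hside a b. hyp_setdist {x} (hplane a b) = arsinh s} =
         {x \<in> hyp_space. sinh_height a b x = s}"
proof -
  have "a \<bullet> x \<le> b \<and> hyp_setdist {x} (hplane a b) = arsinh s \<longleftrightarrow> sinh_height a b x = s"
    if x: "x \<in> hyp_space" for x
    using assms hyp_setdist_point_hplane[OF x] sinh_height_nonneg_iff[OF x]
    by (metis abs_of_nonneg arsinh_le_iff_real less_imp_le order_antisym order_refl)
  then show ?thesis by blast
qed

text \<open>Every point of the level set realizes the same distance to the hyperplane. The point
  \<open>y\<close> guarantees that the infimum runs over a nonempty set.\<close>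

lemma hyp_setdist_hplane_level_set:
  assumes "s > 0" and y: "y \<in> hyp_space" "sinh_height a b y = s"
  shows "hyp_setdist (hplane a b) {x \<in> hyp_space. sinh_height a b x = s} = arsinh s"
proof (rule antisym)
  obtain z where "z \<in> hplane a b" "hyp_dist y z = arsinh s"
    using hyp_dist_hplane(2)[of y] assms by auto
  then show "hyp_setdist (hplane a b) {x \<in> hyp_space. sinh_height a b x = s} \<le> arsinh s"
    using hyp_setdist_le[of "hplane a b" "{x \<in> hyp_space. sinh_height a b x = s}" z y] y
    by (auto simp: hyp_dist_commute)
  show "arsinh s \<le> hyp_setdist (hplane a b) {x \<in> hyp_space. sinh_height a b x = s}"
  proof (rule hyp_setdist_ge)
    fix z x assume "z \<in> hplane a b" "x \<in> {x \<in> hyp_space. sinh_height a b x = s}"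
    then show "arsinh s \<le> hyp_dist z x"
      using hyp_dist_hplane(1)[of x z] assms(1) by (auto simp: hyp_dist_commute)
  qed (use foot_in_hplane y in auto)
qed

text \<open>The upper bound compares the affine function \<open>b - a \<bullet> x\<close> with a
  nonnegative multiple of the concave \<open>sqrt (1 - x \<bullet> x)\<close>. Concavity is obtained
  from the tangent at the convex combination \<open>c\<close> itself.\<close>

lemma convex_sublevel:
  assumes "s \<ge> 0"
  shows "convex {x \<in> hyp_space. 0 \<le> sinh_height a b x \<and> sinh_height a b x \<le> s}" (is "convex ?S")
proof (rule convexI)
  fix x y and u v :: real
  assume x: "x \<in> ?S" and y: "y \<in> ?S" and uv: "u \<ge> 0" "v \<ge> 0" "u + v = 1"
  define c where "c = u *\<^sub>R x + v *\<^sub>R y"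
  define k where "k = sqrt (1 - c \<bullet> c)"
  define S where "S = s * sqrt (1 - b\<^sup>2)"
  have S: "S \<ge> 0" unfolding S_def using assms by (simp add: less_imp_le)
  have c: "c \<in> hyp_space"
    using x y uv convexD[of "hyp_space :: 'a set" x y u v] unfolding c_def hyp_space_def by auto
  then have k: "k > 0" "k * k = 1 - c \<bullet> c" by (simp_all add: k_def hyp_space_iff)
  have ac: "b - a \<bullet> c = u * (b - a \<bullet> x) + v * (b - a \<bullet> y)"
  proof -
    have "u * (b - a \<bullet> x) + v * (b - a \<bullet> y) = (u + v) * b - a \<bullet> c"
      by (simp add: c_def inner_add_right algebra_simps)
    then show ?thesis using uv by simp
  qed
  have xs: "0 \<le> b - a \<bullet> x" "b - a \<bullet> x \<le> S * sqrt (1 - x \<bullet> x)"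
    using x sinh_height_nonneg_iff[of x] sinh_height_le_iff[of x s] by (auto simp: S_def mult.assoc)
  have ys: "0 \<le> b - a \<bullet> y" "b - a \<bullet> y \<le> S * sqrt (1 - y \<bullet> y)"
    using y sinh_height_nonneg_iff[of y] sinh_height_le_iff[of y s] by (auto simp: S_def mult.assoc)
  have "b - a \<bullet> c \<le> u * (S * sqrt (1 - x \<bullet> x)) + v * (S * sqrt (1 - y \<bullet> y))"
    unfolding ac using xs ys uv by (intro add_mono mult_left_mono) auto
  also have "\<dots> = S * (u * sqrt (1 - x \<bullet> x) + v * sqrt (1 - y \<bullet> y))"
    by (simp add: algebra_simps)
  also have "\<dots> \<le> S * (u * ((1 - c \<bullet> x) / k) + v * ((1 - c \<bullet> y) / k))"
    unfolding k_def using x y c uv S by (intro mult_left_mono add_mono sqrt_tangent) auto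
  also have "u * ((1 - c \<bullet> x) / k) + v * ((1 - c \<bullet> y) / k) = ((u + v) - c \<bullet> c) / k"
  proof -
    have "c \<bullet> c = u * (c \<bullet> x) + v * (c \<bullet> y)"
      by (subst (2) c_def) (simp add: inner_add_right)
    then show ?thesis using k(1) by (simp add: field_simps)
  qed
  also have "((u + v) - c \<bullet> c) / k = k" using uv k by (simp add: field_simps)
  finally have "b - a \<bullet> c \<le> S * k" .
  moreover have "0 \<le> b - a \<bullet> c" unfolding ac using xs ys uv by simp
  ultimately show "u *\<^sub>R x + v *\<^sub>R y \<in> ?S"
    using c sinh_height_nonneg_iff[of c] sinh_height_le_iff[of c s]
    by (auto simp: c_def[symmetric] S_def k_def mult.assoc)
qed

text \<open>A point strictly inside the strip is reached from a fixed point of the hyperplane by a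
  segment ending on the level set.  HOL's \<open>sqrt\<close> is odd, hence negative on negative
  arguments, so the intermediate value theorem applies even where the ray has left the ball.\<close>

lemma equidistant_strip_level_set:
  assumes s: "s > 0"
  shows "equidistant_strip (hplane a b) {x \<in> hyp_space. sinh_height a b x = s} =
         {x \<in> hyp_space. 0 \<le> sinh_height a b x \<and> sinh_height a b x \<le> s}" (is "?L = ?R")
proof
  have "hplane a b \<subseteq> ?R"
    using s sinh_height_eq_iff[of _ 0] by force
  then show "?L \<subseteq> ?R"
    unfolding equidistant_strip_def using s convex_sublevel[of s] by (intro hull_minimal) auto
  show "?R \<subseteq> ?L"
  proof
    fix x assume "x \<in> ?R"
    then have x: "x \<in> hyp_space" "0 \<le> sinh_height a b x" "sinh_height a b x \<le> s" by auto
    consider "sinh_height a b x = 0" | "sinh_height a b x = s"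
      | "0 < sinh_height a b x" "sinh_height a b x < s" using x by linarith
    then show "x \<in> ?L"
    proof cases
      case 1
      then have "x \<in> hplane a b" using x sinh_height_eq_iff[of x 0] by auto
      then show ?thesis unfolding equidistant_strip_def by (simp add: hull_inc)
    next
      case 2
      then show ?thesis unfolding equidistant_strip_def using x by (simp add: hull_inc)
    next
      case 3
      define p where "p = b *\<^sub>R a"
      define g where "g = (\<lambda>t. p + t *\<^sub>R (x - p))"
      define S where "S = s * sqrt (1 - b\<^sup>2)"
      define \<phi> where "\<phi> = (\<lambda>t. S * sqrt (1 - g t \<bullet> g t) - t * (b - a \<bullet> x))"
      have S: "S > 0" unfolding S_def using s by simp
      have ax: "a \<bullet> x < b" using 3 x sinh_height_pos_iff[of x] by simp
      have p: "p \<in> hplane a b" "norm p < 1"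
        using foot_in_hplane by (auto simp: p_def hyp_space_norm)
      have bg: "b - a \<bullet> g t = t * (b - a \<bullet> x)" for t
        using p by (simp add: g_def inner_add_right inner_diff_right algebra_simps)
      have "x \<noteq> p" using ax p by auto
      \<comment> \<open>The first summand pushes \<open>g T\<close> to distance at least 2 from
        \<open>p\<close>, hence out of the ball; the second ensures
        \<open>T \<ge> 1\<close>.\<close>
      define T where "T = 2 / norm (x - p) + 1"
      have T: "T \<ge> 1" "T * norm (x - p) \<ge> 2"
        using \<open>x \<noteq> p\<close> by (simp_all add: T_def field_simps)
      have "norm (T *\<^sub>R (x - p)) = norm (g T - p)" by (simp add: g_def)
      also have "\<dots> \<le> norm (g T) + norm p" by (rule norm_triangle_ineq4)
      finally have "norm (g T) \<ge> 1" using T p(2) by simp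
      then have "g T \<bullet> g T \<ge> 1"
        by (simp add: norm_eq_sqrt_inner)
      then have "S * sqrt (1 - g T \<bullet> g T) \<le> 0" using S by (simp add: mult_le_0_iff)
      moreover have "T * (b - a \<bullet> x) > 0" using T ax by simp
      ultimately have \<phi>T: "\<phi> T \<le> 0" by (simp add: \<phi>_def)
      have "\<not> s \<le> sinh_height a b x" using 3 by simp
      then have \<phi>1: "0 \<le> \<phi> 1"
        using x(1) sinh_height_ge_iff[of x s] by (simp add: \<phi>_def g_def S_def mult.assoc)
      have "continuous_on {1..T} \<phi>"
        unfolding \<phi>_def g_def by (intro continuous_intros)
      then obtain t where t: "1 \<le> t" "t \<le> T" "\<phi> t = 0"
        using IVT2'[of \<phi> T 0 1] \<phi>T \<phi>1 T(1) by blast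
      \<comment> \<open>At the zero the square root equals a positive quantity up to a positive
        factor, so the point found lies in the ball after all.\<close>
      have tb: "t * (b - a \<bullet> x) > 0" using t ax by simp
      then have "S * sqrt (1 - g t \<bullet> g t) > 0" using t(3) by (simp add: \<phi>_def)
      then have gt: "g t \<in> hyp_space" using S by (simp add: hyp_space_iff zero_less_mult_iff)
      have "sinh_height a b (g t) = s"
        using sinh_height_eq_iff[OF gt, of s] t(3) bg[of t] by (simp add: \<phi>_def S_def mult.assoc)
      then have "g t \<in> ?L" "p \<in> ?L"
        unfolding equidistant_strip_def using gt p by (auto intro!: hull_inc)
      moreover have "convex ?L" unfolding equidistant_strip_def by (rule convex_convex_hull)
      ultimately have "(1 - 1 / t) *\<^sub>R p + (1 / t) *\<^sub>R g t \<in> ?L"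
        using t by (intro convexD) auto
      moreover have "(1 - 1 / t) *\<^sub>R p + (1 / t) *\<^sub>R g t = x"
        using t(1) by (simp add: g_def algebra_simps)
      ultimately show ?thesis by simp
    qed
  qed
qed

end

subsection \<open>Width and the nearest equidistant surface\<close>

lemma hplane_offset_less_one:
  assumes "norm a = 1" "hplane a b \<noteq> {}"
  shows "\<bar>b\<bar> < 1"
proof -
  obtain p where p: "norm p < 1" "a \<bullet> p = b" using assms(2) by (auto simp: hyp_space_norm)
  have "\<bar>a \<bullet> p\<bar> \<le> norm a * norm p" by (rule Cauchy_Schwarz_ineq2)
  then show ?thesis using p assms(1) by simp
qed

text \<open>Dividing by \<open>norm a\<close> gives access to the distance formulas, which assume
  unit normals; meeting the open ball then amounts to \<open>\<bar>b\<bar> < 1\<close>.\<close>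

lemma hyp_halfspace_iff:
  "hyp_halfspace H K \<longleftrightarrow>
    (\<exists>a b. norm a = 1 \<and> \<bar>b\<bar> < 1 \<and> H = hplane a b \<and> K = hside a b)" (is "?L \<longleftrightarrow> ?R")
proof
  assume ?L
  then obtain a b where H: "H \<noteq> {}" "a \<noteq> 0" "H = hplane a b" "K = hside a b"
    unfolding hyp_halfspace_def by blast
  define c d where "c = (1 / norm a) *\<^sub>R a" and "d = b / norm a"
  have "norm c = 1" using H by (simp add: c_def)
  moreover have "c \<bullet> x = d \<longleftrightarrow> a \<bullet> x = b" "c \<bullet> x \<le> d \<longleftrightarrow> a \<bullet> x \<le> b" for x
    using H by (simp_all add: c_def d_def divide_le_cancel)
  ultimately show ?R using H hplane_offset_less_one[of c d] by (intro exI[of _ c] exI[of _ d]) auto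
next
  assume ?R
  then obtain a b where "norm a = 1" "\<bar>b\<bar> < 1" "H = hplane a b" "K = hside a b" by blast
  then show ?L unfolding hyp_halfspace_def using foot_in_hplane[of a b]
    by (intro conjI exI[of _ a] exI[of _ b]) (auto simp: norm_eq_1)
qed

lemma hyp_hyperplane_iff:
  "hyp_hyperplane H \<longleftrightarrow> (\<exists>K. hyp_halfspace H K)"
  unfolding hyp_hyperplane_def hyp_halfspace_def by blast

lemma supporting_hyperplane_iff:
  "supporting_hyperplane H C \<longleftrightarrow>
    (\<exists>a b. norm a = 1 \<and> \<bar>b\<bar> < 1 \<and> H = hplane a b \<and> C \<subseteq> hside a b \<and> H \<inter> C \<noteq> {})"
  unfolding supporting_hyperplane_def hyp_hyperplane_iff hyp_halfspace_iff by blast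

text \<open>The trace in the ball contains a short segment from \<open>p\<close> in the direction
  \<open>v\<close>, the part of \<open>a'\<close> orthogonal to \<open>a\<close>. Since
  \<open>a'\<close> is constant along it, \<open>v\<close> is orthogonal to \<open>a'\<close> and
  vanishes. Hence a hyperplane bounds only two half-spaces.\<close>

lemma hplane_eq_imp:
  fixes a a' :: "'a::euclidean_space"
  assumes a: "norm a = 1" "\<bar>b\<bar> < 1" and a': "norm a' = 1" and eq: "hplane a b = hplane a' b'"
  shows "a' = a \<and> b' = b \<or> a' = - a \<and> b' = - b"
proof -
  define p where "p = b *\<^sub>R a"
  define u where "u = a \<bullet> a'"
  define v where "v = a' - u *\<^sub>R a"
  have aa: "a \<bullet> a = 1" "a' \<bullet> a' = 1" using a a' by (simp_all add: norm_eq_1)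
  have p: "p \<in> hplane a b" unfolding p_def using foot_in_hplane a by blast
  have av: "a \<bullet> v = 0" by (simp add: v_def inner_diff_right aa u_def)
  have "open (hyp_space :: 'a set)" by (simp add: hyp_space_def)
  then obtain \<epsilon> where \<epsilon>: "\<epsilon> > 0" "ball p \<epsilon> \<subseteq> hyp_space"
    using p by (auto simp: open_contains_ball)
  \<comment> \<open>Small enough to keep \<open>p + t *\<^sub>R v\<close> within
    \<open>\<epsilon>\<close> of \<open>p\<close>; the summand 1 covers the case
    \<open>v = 0\<close>.\<close>
  define t where "t = \<epsilon> / (2 * (norm v + 1))"
  have t: "t > 0" using \<epsilon> by (simp add: t_def add_nonneg_pos)
  have "norm (t *\<^sub>R v) = \<epsilon> * (norm v / (2 * (norm v + 1)))"
    using \<epsilon> by (simp add: t_def)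
  also have "\<dots> < \<epsilon> * 1"
    using \<epsilon> by (intro mult_strict_left_mono) (auto simp: divide_less_eq add_nonneg_pos intro: add_nonneg_pos)
  finally have "p + t *\<^sub>R v \<in> hyp_space" using \<epsilon> by (auto simp: dist_norm)
  then have "p + t *\<^sub>R v \<in> hplane a b" using p av by (simp add: inner_add_right)
  then have "a' \<bullet> (p + t *\<^sub>R v) = b'" "a' \<bullet> p = b'" using eq p by auto
  then have av': "a' \<bullet> v = 0" using t by (simp add: inner_add_right)
  have "v \<bullet> v = a' \<bullet> v - u * (a \<bullet> v)"
    by (subst (1) v_def) (simp add: inner_diff_left)
  then have "v = 0" using av av' by simp
  then have a'u: "a' = u *\<^sub>R a" by (simp add: v_def)
  then have "\<bar>u\<bar> = 1" using a a' by simp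
  moreover have "b' = u * b" using \<open>a' \<bullet> p = b'\<close> a'u by (simp add: p_def aa mult.commute)
  ultimately show ?thesis using a'u by (auto simp: abs_if split: if_splits)
qed

lemma convex_body_not_in_hyperplane:
  fixes C :: "'a::euclidean_space set"
  assumes "convex_body C" "a \<noteq> 0"
  shows "\<exists>x \<in> C. a \<bullet> x \<noteq> b"
proof (rule ccontr)
  assume "\<not> ?thesis"
  then have "C \<subseteq> {x. a \<bullet> x = b}" by blast
  then have "interior C \<subseteq> interior {x. a \<bullet> x = b}" by (rule interior_mono)
  then show False using assms by (simp add: interior_hyperplane convex_body_def)
qed

section \<open>Farthest points, width and equidistant surfaces\<close>

lemma continuous_on_sinh_height:
  assumes "norm a = 1" "\<bar>b\<bar> < 1" "C \<subseteq> hyp_space"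
  shows "continuous_on C (sinh_height a b)"
proof -
  have "sqrt (1 - b\<^sup>2) * sqrt (1 - x \<bullet> x) \<noteq> 0" if "x \<in> C" for x
    using sinh_height_denominator_pos[of a b x] assms that by auto
  then show ?thesis
    unfolding sinh_height_def by (intro continuous_intros) auto
qed

lemma obtain_farthest:
  assumes "convex_body C" "norm a = 1" "\<bar>b\<bar> < 1"
  obtains c where "c \<in> C" "\<And>x. x \<in> C \<Longrightarrow> sinh_height a b x \<le> sinh_height a b c"
proof -
  have "compact C" "C \<noteq> {}" "C \<subseteq> hyp_space" using assms by (auto simp: convex_body_def)
  then show ?thesis
    using continuous_attains_sup[of C "sinh_height a b"] continuous_on_sinh_height[of a b C] assms that
    by blast
qed

text \<open>A body has interior points and so is not contained in the hyperplane. Positivity makes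
  the level set through \<open>c\<close> a genuine equidistant surface.\<close>

lemma farthest_pos:
  assumes "convex_body C" "norm a = 1" "\<bar>b\<bar> < 1" "C \<subseteq> hside a b"
    and "c \<in> C" "\<And>x. x \<in> C \<Longrightarrow> sinh_height a b x \<le> sinh_height a b c"
  shows "sinh_height a b c > 0"
proof -
  obtain x where x: "x \<in> C" "a \<bullet> x \<noteq> b"
    using convex_body_not_in_hyperplane[OF assms(1), of a b] assms(2) by (metis norm_zero zero_neq_one)
  then have "x \<in> hyp_space" "a \<bullet> x < b" using assms(4) by force+
  then have "sinh_height a b x > 0" using sinh_height_pos_iff assms by blast
  then show ?thesis using assms(6)[OF x(1)] by simp
qed

text \<open>Any competing hyperplane touches \<open>C\<close> at a point no higher than
  \<open>c\<close>, which bounds its distance from above. The bound is attained by the hyperplane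
  tangent at \<open>c\<close> to the level set through \<open>c\<close>.\<close>

lemma width_hplane:
  fixes C :: "'a::euclidean_space set"
  assumes C: "convex_body C" and a: "norm a = 1" and b: "\<bar>b\<bar> < 1" and side: "C \<subseteq> hside a b"
    and c: "c \<in> C" and max: "\<And>x. x \<in> C \<Longrightarrow> sinh_height a b x \<le> sinh_height a b c"
  shows "width (hplane a b) C = arsinh (sinh_height a b c)"
proof -
  let ?H = "hplane a b"
  let ?F = "{G. supporting_hyperplane G C \<and> ultraparallel ?H G}"
  define s where "s = sinh_height a b c"
  have s: "s > 0" unfolding s_def using farthest_pos[OF C a b side c max] by blast
  have CB: "C \<subseteq> hyp_space" using C by (simp add: convex_body_def)
  have upper: "hyp_setdist ?H G \<le> arsinh s" if G: "G \<in> ?F" for G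
  proof -
    obtain x where x: "x \<in> G" "x \<in> C" and "G \<subseteq> hyp_space"
      using G by (auto simp: supporting_hyperplane_iff)
    have xB: "x \<in> hyp_space" using x CB by blast
    obtain y where y: "y \<in> ?H" "hyp_dist x y = arsinh \<bar>sinh_height a b x\<bar>"
      using hyp_dist_hplane(2)[OF a b xB] by blast
    have "hyp_setdist ?H G \<le> hyp_dist y x"
      using x y \<open>G \<subseteq> hyp_space\<close> by (intro hyp_setdist_le) auto
    also have "\<dots> = arsinh (sinh_height a b x)"
      using y x side sinh_height_nonneg_iff[OF a b xB] by (auto simp: hyp_dist_commute)
    also have "\<dots> \<le> arsinh s" using max[OF x(2)] by (simp add: s_def arsinh_le_iff_real)
    finally show ?thesis .
  qed
  define k where "k = sqrt (1 - c \<bullet> c)"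
  define S where "S = s * sqrt (1 - b\<^sup>2)"
  \<comment> \<open>The level set satisfies
    \<open>b - a \<bullet> x = S * sqrt (1 - x \<bullet> x)\<close>. Replacing the square root by
    its tangent at \<open>c\<close> yields the affine equation
    \<open>n \<bullet> x = \<beta>\<close>.\<close>
  define n where "n = (S / k) *\<^sub>R c - a"
  define \<beta> where "\<beta> = S / k - b"
  have cB: "c \<in> hyp_space" using c CB by blast
  have k: "k > 0" using cB by (simp add: k_def hyp_space_iff)
  have S: "S > 0" unfolding S_def using s offset_square_less_one[OF a b] by simp
  have \<psi>: "\<beta> - n \<bullet> x = S * ((1 - c \<bullet> x) / k) - (b - a \<bullet> x)" for x
    unfolding \<beta>_def n_def using k by (simp add: inner_diff_left field_simps)
  have tangent: "S * sqrt (1 - x \<bullet> x) - (b - a \<bullet> x) \<le> \<beta> - n \<bullet> x" if "x \<in> hyp_space" for x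
    unfolding \<psi> k_def
    by (intro diff_right_mono mult_left_mono sqrt_tangent[OF cB that]) (use S in simp)
  have nc: "n \<bullet> c = \<beta>"
  proof -
    have "b - a \<bullet> c = S * k"
      using sinh_height_eq_iff[OF a b cB, of s] by (simp add: s_def S_def k_def mult.assoc)
    moreover have "1 - c \<bullet> c = k * k" using cB by (simp add: k_def hyp_space_iff)
    ultimately show ?thesis using \<psi>[of c] k by simp
  qed
  \<comment> \<open>If \<open>n\<close> vanished, so would \<open>\<beta>\<close>, and the tangent
    inequality would fail at the point \<open>b *\<^sub>R a\<close>, where
    \<open>b - a \<bullet> x\<close> is zero.\<close>
  have "n \<noteq> 0"
  proof
    assume "n = 0"
    then have "\<beta> = 0" using nc by simp
    have p: "b *\<^sub>R a \<in> ?H" by (rule foot_in_hplane[OF a b])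
    then have "S * sqrt (1 - (b *\<^sub>R a) \<bullet> (b *\<^sub>R a)) \<le> 0"
      using tangent[of "b *\<^sub>R a"] \<open>n = 0\<close> \<open>\<beta> = 0\<close> by auto
    moreover have "sqrt (1 - (b *\<^sub>R a) \<bullet> (b *\<^sub>R a)) > 0" using p by (simp add: hyp_space_iff)
    ultimately show False using S by (simp add: mult_le_0_iff)
  qed
  define G where "G = hplane n \<beta>"
  have cG: "c \<in> G" unfolding G_def using nc cB by simp
  have "C \<subseteq> hside n \<beta>"
  proof
    fix x assume x: "x \<in> C"
    then have xB: "x \<in> hyp_space" using CB by blast
    have "b - a \<bullet> x \<le> S * sqrt (1 - x \<bullet> x)"
      using max[OF x] sinh_height_le_iff[OF a b xB, of s] by (simp add: s_def S_def mult.assoc)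
    then show "x \<in> hside n \<beta>" using tangent[OF xB] xB by simp
  qed
  moreover have half: "hyp_halfspace G (hside n \<beta>)"
    unfolding hyp_halfspace_def using \<open>n \<noteq> 0\<close> cG by (auto simp: G_def)
  ultimately have sup: "supporting_hyperplane G C"
    unfolding supporting_hyperplane_def hyp_hyperplane_iff using cG c by blast
  \<comment> \<open>On the closed ball with \<open>a \<bullet> x = b\<close>, the quantity
    \<open>\<beta> - n \<bullet> x\<close> is a positive multiple of
    \<open>1 - c \<bullet> x\<close>. This is positive even at ideal points, because
    \<open>c\<close> is inside the open ball.\<close>
  have "closure ?H \<inter> closure G = {}"
  proof -
    have "closure ?H \<subseteq> {x. norm x \<le> 1} \<inter> {x. a \<bullet> x = b}"
      by (intro closure_minimal closed_Int closed_hyperplane closed_Collect_le continuous_intros)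
        (auto simp: hyp_space_norm)
    moreover have "closure G \<subseteq> {x. n \<bullet> x = \<beta>}"
      by (intro closure_minimal closed_hyperplane) (auto simp: G_def)
    moreover have False if x: "norm x \<le> 1" "a \<bullet> x = b" "n \<bullet> x = \<beta>" for x
    proof -
      have "c \<bullet> x < 1" using cB x by (intro inner_less_one) (auto simp: hyp_space_norm)
      then have "S * ((1 - c \<bullet> x) / k) > 0" using S k by simp
      then show False using \<psi>[of x] x by linarith
    qed
    ultimately show ?thesis by blast
  qed
  moreover have "hyp_hyperplane ?H"
    using a b by (auto simp: hyp_hyperplane_iff hyp_halfspace_iff)
  ultimately have GF: "G \<in> ?F"
    using sup half by (auto simp: ultraparallel_def hyp_hyperplane_iff)
  \<comment> \<open>The tangent inequality also shows that the level set of \<open>s\<close>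
    separates \<open>G\<close> from the base hyperplane.\<close>
  have lower: "arsinh s \<le> hyp_setdist ?H G"
  proof (rule hyp_setdist_ge)
    fix y x assume y: "y \<in> ?H" and "x \<in> G"
    then have x: "x \<in> hyp_space" "n \<bullet> x = \<beta>" by (auto simp: G_def)
    then have "s \<le> sinh_height a b x"
      using tangent[OF x(1)] sinh_height_ge_iff[OF a b x(1), of s] by (simp add: S_def mult.assoc)
    then have "arsinh s \<le> arsinh \<bar>sinh_height a b x\<bar>" by (simp add: arsinh_le_iff_real)
    also have "\<dots> \<le> hyp_dist y x"
      using hyp_dist_hplane(1)[OF a b x(1) y] by (simp add: hyp_dist_commute)
    finally show "arsinh s \<le> hyp_dist y x" .
  qed (use foot_in_hplane[OF a b] cG in auto)
  have "bdd_above ((\<lambda>G. hyp_setdist ?H G) ` ?F)"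
    using upper by (intro bdd_aboveI2[of _ _ "arsinh s"]) auto
  then have "arsinh s \<le> width ?H C"
    unfolding width_def using lower GF by (intro cSUP_upper2) auto
  moreover have "width ?H C \<le> arsinh s"
    unfolding width_def using upper GF by (intro cSUP_least) auto
  ultimately show ?thesis by (simp add: s_def)
qed

text \<open>Every admissible surface is a level set \<open>L s'\<close> on the side of
  \<open>C\<close> with \<open>s' \<ge> s\<close>, and its distance to the hyperplane determines
  \<open>s'\<close>. So \<open>L s\<close> is the unique minimizer, as the definite description
  requires.\<close>

lemma nearest_equidistant_hplane:
  fixes C :: "'a::euclidean_space set"
  assumes C: "convex_body C" and a: "norm a = 1" and b: "\<bar>b\<bar> < 1" and side: "C \<subseteq> hside a b"
    and c: "c \<in> C" and max: "\<And>x. x \<in> C \<Longrightarrow> sinh_height a b x \<le> sinh_height a b c"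
  shows "nearest_equidistant (hplane a b) C =
    {x \<in> hyp_space. sinh_height a b x = sinh_height a b c}"
proof -
  let ?H = "hplane a b"
  define s where "s = sinh_height a b c"
  define L where "L = (\<lambda>s. {x \<in> hyp_space. sinh_height a b x = s})"
  have s: "s > 0" unfolding s_def using farthest_pos[OF C a b side c max] by blast
  have CB: "C \<subseteq> hyp_space" using C by (simp add: convex_body_def)
  have half: "hyp_halfspace ?H (hside a b)"
    using a b by (auto simp: hyp_halfspace_iff)
  have aH: "\<exists>x \<in> C. a \<bullet> x \<noteq> b"
    using convex_body_not_in_hyperplane[OF C, of a b] a by (metis norm_zero zero_neq_one)
  have surface: "equidistant_surface ?H (L s)"
    unfolding equidistant_surface_def hyp_hyperplane_iff
    using half s level_set_eq_equidistant[OF a b s]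
    by (intro conjI exI[of _ "hside a b"] exI[of _ "arsinh s"]) (auto simp: L_def)
  have strip: "C \<subseteq> equidistant_strip ?H (L s)"
    unfolding L_def equidistant_strip_level_set[OF a b s]
    using CB side max sinh_height_nonneg_iff[OF a b] by (auto simp: s_def)
  have dL: "hyp_setdist ?H (L s) = arsinh s"
    unfolding L_def using hyp_setdist_hplane_level_set[OF a b s, of c] c CB by (auto simp: s_def)
  have other: "\<exists>s' \<ge> s. E = L s' \<and> hyp_setdist ?H E = arsinh s'"
    if E: "equidistant_surface ?H E" and CE: "C \<subseteq> equidistant_strip ?H E" for E
  proof -
    obtain K r where K: "hyp_halfspace ?H K" "r > 0" and EK: "E = {x \<in> K. hyp_setdist {x} ?H = r}"
      using E unfolding equidistant_surface_def by blast
    obtain a' b' where a': "norm a' = 1" "?H = hplane a' b'" "K = hside a' b'"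
      using K unfolding hyp_halfspace_iff by metis
    \<comment> \<open>With \<open>E\<close> empty the strip would shrink to the hyperplane, which
      cannot contain a body.\<close>
    have "E \<noteq> {}"
    proof
      assume "E = {}"
      moreover have "convex ?H"
      proof -
        have "?H = ball 0 1 \<inter> {x. a \<bullet> x = b}" by (auto simp: hyp_space_def)
        then show ?thesis by (simp add: convex_Int convex_hyperplane)
      qed
      ultimately have "C \<subseteq> ?H" using CE by (simp add: equidistant_strip_def hull_same)
      then show False using aH by blast
    qed
    \<comment> \<open>A surface on the opposite side would put \<open>C\<close> into both closed
      half-spaces, hence into the hyperplane.\<close>
    have "K = hside a b"
    proof (rule ccontr)
      assume "K \<noteq> hside a b"
      then have "a' = - a" "b' = - b" using hplane_eq_imp[OF a b a'(1,2)] a'(3) by auto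
      then have Kc: "K = hyp_space \<inter> {x. (- a) \<bullet> x \<le> - b}" using a'(3) by auto
      then have "convex K"
        by (metis convex_Int convex_ball convex_halfspace_le hyp_space_def)
      moreover have "?H \<subseteq> K" "E \<subseteq> K" using Kc EK by auto
      ultimately have "equidistant_strip ?H E \<subseteq> K"
        unfolding equidistant_strip_def by (intro hull_minimal) auto
      then show False using CE Kc side aH by force
    qed
    define s' where "s' = sinh r"
    have s': "s' > 0" "r = arsinh s'" using K by (simp_all add: s'_def arsinh_sinh_real)
    have EL: "E = L s'"
      unfolding EK \<open>K = hside a b\<close> L_def s'(2) using level_set_eq_equidistant[OF a b s'(1)] by simp
    then have "c \<in> {x \<in> hyp_space. 0 \<le> sinh_height a b x \<and> sinh_height a b x \<le> s'}"
      using CE c equidistant_strip_level_set[OF a b s'(1)] by (auto simp: L_def)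
    then have "s \<le> s'" by (simp add: s_def)
    moreover have "hyp_setdist ?H E = arsinh s'"
      using EL \<open>E \<noteq> {}\<close> hyp_setdist_hplane_level_set[OF a b s'(1)] by (auto simp: L_def)
    ultimately show ?thesis using EL by blast
  qed
  have "nearest_equidistant ?H C = L s"
    unfolding nearest_equidistant_def
  proof (intro the_equality conjI allI impI)
    fix E' assume "equidistant_surface ?H E' \<and> C \<subseteq> equidistant_strip ?H E'"
    then obtain s' where "s \<le> s'" "hyp_setdist ?H E' = arsinh s'" using other by blast
    then show "hyp_setdist ?H (L s) \<le> hyp_setdist ?H E'" by (simp add: dL arsinh_le_iff_real)
  next
    fix E assume E: "equidistant_surface ?H E \<and> C \<subseteq> equidistant_strip ?H E \<and>
      (\<forall>E'. equidistant_surface ?H E' \<and> C \<subseteq> equidistant_strip ?H E' \<longrightarrow>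
        hyp_setdist ?H E \<le> hyp_setdist ?H E')"
    then obtain s' where s': "s \<le> s'" "E = L s'" "hyp_setdist ?H E = arsinh s'"
      using other by blast
    have "arsinh s' \<le> arsinh s"
      unfolding s'(3)[symmetric] dL[symmetric] using E surface strip by blast
    then show "E = L s" using s' by (simp add: arsinh_le_iff_real)
  qed (rule surface strip)+
  then show ?thesis by (simp add: L_def s_def)
qed

text \<open>Both sides are \<open>arsinh\<close> of the maximal height. The thickness condition of
  the theorem thereby becomes a condition on the width.\<close>

lemma strip_thickness_nearest_equidistant:
  fixes C :: "'a::euclidean_space set"
  assumes "convex_body C" "supporting_hyperplane H C"
  shows "strip_thickness H (nearest_equidistant H C) = width H C"
proof -
  obtain a b where ab: "norm a = 1" "\<bar>b\<bar> < 1" "H = hplane a b" "C \<subseteq> hside a b"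
    using assms(2) unfolding supporting_hyperplane_iff by blast
  obtain c where c: "c \<in> C" "\<And>x. x \<in> C \<Longrightarrow> sinh_height a b x \<le> sinh_height a b c"
    using obtain_farthest[OF assms(1) ab(1,2)] by blast
  have "c \<in> hyp_space" using c ab by blast
  then show ?thesis
    using nearest_equidistant_hplane[OF assms(1) ab(1,2,4) c] width_hplane[OF assms(1) ab(1,2,4) c]
      hyp_setdist_hplane_level_set[OF ab(1,2) farthest_pos[OF assms(1) ab(1,2,4) c]]
    by (simp add: ab(3) strip_thickness_def)
qed

section \<open>Thickness as an infimum of widths\<close>

lemma width_nonneg:
  assumes "convex_body C" "supporting_hyperplane H C"
  shows "width H C \<ge> 0"
proof -
  obtain a b where ab: "norm a = 1" "\<bar>b\<bar> < 1" "H = hplane a b" "C \<subseteq> hside a b"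
    using assms(2) unfolding supporting_hyperplane_iff by blast
  obtain c where c: "c \<in> C" "\<And>x. x \<in> C \<Longrightarrow> sinh_height a b x \<le> sinh_height a b c"
    using obtain_farthest[OF assms(1) ab(1,2)] by blast
  have "arsinh (sinh_height a b c) > 0"
    using farthest_pos[OF assms(1) ab(1,2,4) c] by simp
  then show ?thesis
    unfolding ab(3) using width_hplane[OF assms(1) ab(1,2,4) c] by linarith
qed

lemma thickness_le_width:
  assumes "convex_body C" "supporting_hyperplane H C"
  shows "thickness C \<le> width H C"
  unfolding thickness_def
  using assms by (intro cINF_lower bdd_belowI2[of _ 0]) (auto simp: width_nonneg)

text \<open>A maximizer of a linear functional provides one; this makes the infimum in
  \<open>thickness\<close> range over a nonempty family.\<close>

lemma supporting_hyperplane_exists: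
  fixes C :: "'a::euclidean_space set"
  assumes "convex_body C"
  shows "\<exists>H. supporting_hyperplane H C"
proof -
  obtain a :: 'a where a: "norm a = 1" using vector_choose_size[of 1] by auto
  have C: "compact C" "C \<noteq> {}" "C \<subseteq> hyp_space" using assms by (auto simp: convex_body_def)
  then obtain z where z: "z \<in> C" "\<And>x. x \<in> C \<Longrightarrow> a \<bullet> x \<le> a \<bullet> z"
    using continuous_attains_sup[of C "\<lambda>x. a \<bullet> x"] continuous_on_inner[of C "\<lambda>x. a" "\<lambda>x. x"]
    by auto
  then have "z \<in> hplane a (a \<bullet> z)" using C by blast
  then have "supporting_hyperplane (hplane a (a \<bullet> z)) C"
    unfolding supporting_hyperplane_iff
    using a z C hplane_offset_less_one[of a "a \<bullet> z"] by (intro exI[of _ a] exI[of _ "a \<bullet> z"]) blast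
  then show ?thesis by blast
qed

lemma thickness_lessD:
  assumes "convex_body C" "thickness C < r"
  shows "\<exists>H. supporting_hyperplane H C \<and> width H C < r"
proof -
  have "{H. supporting_hyperplane H C} \<noteq> {}" using supporting_hyperplane_exists assms by blast
  moreover have "bdd_below ((\<lambda>H. width H C) ` {H. supporting_hyperplane H C})"
    using assms(1) by (intro bdd_belowI2[of _ 0]) (auto simp: width_nonneg)
  ultimately show ?thesis
    using cINF_less_iff[of "{H. supporting_hyperplane H C}" "\<lambda>H. width H C" r] assms
    unfolding thickness_def by auto
qed

subsection \<open>Reduced bodies\<close>

text \<open>The conclusion is phrased by weak inequalities, which can be passed to a limit. The
  point \<open>z\<close> ties the base hyperplane to the compact set \<open>R\<close>, and
  \<open>q\<close> keeps the truncated body from losing its interior.\<close>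

lemma reduced_body_truncation:
  fixes R :: "'a::euclidean_space set" and e q :: 'a
  assumes R: "reduced_body R" and e: "e extreme_point_of R"
    and \<rho>: "\<rho> > 0" and q: "q \<in> interior (R - ball e \<rho>)"
  shows "\<exists>a b z x. norm a = 1 \<and> \<bar>b\<bar> < 1 \<and> z \<in> R \<and> a \<bullet> z = b \<and> x \<in> R \<inter> ball e \<rho> \<and>
    (\<forall>y \<in> R - ball e \<rho>. a \<bullet> y \<le> b \<and> sinh_height a b y \<le> sinh (thickness R)) \<and>
    (b \<le> a \<bullet> x \<or> sinh (thickness R) \<le> sinh_height a b x)"
proof -
  define Z where "Z = convex hull (R - ball e \<rho>)"
  have bR: "convex_body R" using R by (simp add: reduced_body_def)
  then have R': "R \<subseteq> hyp_space" "compact R" "convex R" by (auto simp: convex_body_def)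
  have ZR: "Z \<subseteq> R" unfolding Z_def using R'(3) by (intro hull_minimal) auto
  have sub: "R - ball e \<rho> \<subseteq> Z" unfolding Z_def by (rule hull_subset)
  have "compact Z"
    unfolding Z_def using R'(2) by (intro compact_convex_hull compact_diff) auto
  moreover have "q \<in> interior Z" using q interior_mono[OF sub] by blast
  ultimately have bZ: "convex_body Z"
    using ZR R'(1) by (auto simp: convex_body_def Z_def convex_convex_hull)
  have "e \<in> R" using e by (simp add: extreme_point_of_def)
  \<comment> \<open>An extreme point of \<open>R\<close> lying in \<open>Z\<close> is extreme in
    \<open>Z\<close>, and extreme points of a convex hull belong to the generating set, from which
    \<open>e\<close> was removed.\<close>
  have "e \<notin> Z"
  proof
    assume "e \<in> Z"
    then have "e extreme_point_of Z" using e ZR unfolding extreme_point_of_def by blast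
    then have "e \<in> R - ball e \<rho>" unfolding Z_def by (rule extreme_point_of_convex_hull)
    then show False using \<rho> by simp
  qed
  then have "Z \<subset> R" using ZR \<open>e \<in> R\<close> by blast
  then have "thickness Z < thickness R" using R bZ by (auto simp: reduced_body_def)
  then obtain H where H: "supporting_hyperplane H Z" "width H Z < thickness R"
    using thickness_lessD[OF bZ] by blast
  obtain a b where ab: "norm a = 1" "\<bar>b\<bar> < 1" "H = hplane a b" "Z \<subseteq> hside a b" "H \<inter> Z \<noteq> {}"
    using H(1) unfolding supporting_hyperplane_iff by blast
  obtain z where z: "z \<in> Z" "z \<in> hplane a b" using ab(3,5) by blast
  obtain c where c: "c \<in> Z" "\<And>y. y \<in> Z \<Longrightarrow> sinh_height a b y \<le> sinh_height a b c"
    using obtain_farthest[OF bZ ab(1,2)] by blast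
  define D where "D = sinh (thickness R)"
  have D: "thickness R = arsinh D" by (simp add: D_def arsinh_sinh_real)
  have cD: "sinh_height a b c < D"
    using H(2) width_hplane[OF bZ ab(1,2,4) c] ab(3) D by simp
  \<comment> \<open>Otherwise \<open>H\<close>, which touches \<open>R\<close> at \<open>z\<close>,
    would support \<open>R\<close> with width below \<open>thickness R\<close>.\<close>
  have "\<exists>x \<in> R. b < a \<bullet> x \<or> D \<le> sinh_height a b x"
  proof (rule ccontr)
    assume neg: "\<not> ?thesis"
    then have side: "R \<subseteq> hside a b" using R'(1) by force
    then have sup: "supporting_hyperplane H R"
      unfolding supporting_hyperplane_iff using ab z ZR by blast
    obtain d where d: "d \<in> R" "\<And>y. y \<in> R \<Longrightarrow> sinh_height a b y \<le> sinh_height a b d"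
      using obtain_farthest[OF bR ab(1,2)] by blast
    then have "sinh_height a b d < D" using neg by force
    then have "width H R < thickness R"
      using width_hplane[OF bR ab(1,2) side d] ab(3) D by simp
    then show False using thickness_le_width[OF bR sup] by simp
  qed
  then obtain x where x: "x \<in> R" "b < a \<bullet> x \<or> D \<le> sinh_height a b x" by blast
  \<comment> \<open>The condition violated by \<open>x\<close> holds throughout \<open>Z\<close>, so
    \<open>x\<close> was cut off and lies in the ball.\<close>
  have "x \<notin> Z"
    using x(2) c(2)[of x] cD ab(4) by force
  then have "x \<in> R \<inter> ball e \<rho>" using x sub by blast
  moreover have "\<forall>y \<in> R - ball e \<rho>. a \<bullet> y \<le> b \<and> sinh_height a b y \<le> D"
    using sub c(2) cD ab(4) by force
  moreover have "z \<in> R" "a \<bullet> z = b" using z ZR by auto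
  ultimately show ?thesis
    using ab(1,2) x(2) unfolding D_def[symmetric]
    by (intro exI[of _ a] exI[of _ b] exI[of _ z] exI[of _ x]) auto
qed

section \<open>Passage to the limit of the thin strips\<close>

theorem theorem1:
  fixes R :: "'a::euclidean_space set" and e :: 'a
  assumes "reduced_body R"
    and "e extreme_point_of R"
  shows "\<exists>H. supporting_hyperplane H R \<and>
           (e \<in> H \<or> e \<in> nearest_equidistant H R) \<and>
           strip_thickness H (nearest_equidistant H R) = thickness R"
proof -
  have bR: "convex_body R" using assms(1) by (simp add: reduced_body_def)
  then have R: "R \<subseteq> hyp_space" "compact R" "interior R \<noteq> {}" by (auto simp: convex_body_def)
  have eR: "e \<in> R" using assms(2) by (simp add: extreme_point_of_def)
  then have eB: "e \<in> hyp_space" using R by blast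
  define D where "D = sinh (thickness R)"
  have D: "thickness R = arsinh D" by (simp add: D_def arsinh_sinh_real)
  have "interior R \<noteq> {e}" using not_open_singleton[of e] open_interior[of R] by metis
  then obtain q where q: "q \<in> interior R" "q \<noteq> e" using R(3) by blast
  \<comment> \<open>Half the distance to \<open>q\<close>, so that \<open>q\<close> stays outside
    all the closed balls of radius \<open>\<rho> n\<close> around \<open>e\<close>.\<close>
  define \<epsilon> where "\<epsilon> = dist e q / 2"
  have \<epsilon>: "\<epsilon> > 0" using q by (simp add: \<epsilon>_def)
  define \<rho> where "\<rho> = (\<lambda>n. \<epsilon> * inverse (real (Suc n)))"
  have \<rho>_pos: "\<rho> n > 0" for n using \<epsilon> by (simp add: \<rho>_def)
  have \<rho>_lim: "\<rho> \<longlonglongrightarrow> 0"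
    unfolding \<rho>_def using tendsto_mult[OF tendsto_const LIMSEQ_inverse_real_of_nat, of \<epsilon>] by simp
  have q_int: "q \<in> interior (R - ball e (\<rho> n))" for n
  proof -
    have "\<rho> n \<le> \<epsilon> * 1"
      unfolding \<rho>_def using \<epsilon> by (intro mult_left_mono) (auto simp: inverse_le_1_iff)
    then have "\<rho> n < dist e q" using \<epsilon> unfolding \<epsilon>_def by linarith
    then have "q \<in> interior R - cball e (\<rho> n)" using q by auto
    moreover have "interior R - cball e (\<rho> n) \<subseteq> R - ball e (\<rho> n)"
      using interior_subset[of R] by auto
    ultimately show ?thesis
      by (meson interior_maximal open_Diff open_interior closed_cball subsetD)
  qed
  define P where "P = (\<lambda>n a b z x. norm a = 1 \<and> \<bar>b\<bar> < 1 \<and> z \<in> R \<and> a \<bullet> z = b \<and>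
    x \<in> R \<inter> ball e (\<rho> n) \<and>
    (\<forall>y \<in> R - ball e (\<rho> n). a \<bullet> y \<le> b \<and> sinh_height a b y \<le> D) \<and>
    (b \<le> a \<bullet> x \<or> D \<le> sinh_height a b x))"
  have "\<exists>a b z x. P n a b z x" for n
    unfolding P_def D_def using reduced_body_truncation[OF assms \<rho>_pos q_int] .
  then obtain a b z x where P: "\<And>n. P n (a n) (b n) (z n) (x n)" by metis
  have x_lim: "x \<longlonglongrightarrow> e"
  proof (rule metric_tendsto_imp_tendsto[OF \<rho>_lim])
    have "dist (x n) e \<le> dist (\<rho> n) 0" for n
      using P[of n] \<rho>_pos[of n] by (auto simp: P_def dist_commute)
    then show "\<forall>\<^sub>F n in sequentially. dist (x n) e \<le> dist (\<rho> n) 0" by simp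
  qed
  \<comment> \<open>Only normals and touching points need a convergent subsequence; the offsets
    follow from \<open>b n = a n \<bullet> z n\<close>.\<close>
  have "seq_compact (sphere (0::'a) 1 \<times> R)"
    using R(2) by (intro compact_imp_seq_compact compact_Times) auto
  moreover have "\<forall>n. (a n, z n) \<in> sphere 0 1 \<times> R" using P by (auto simp: P_def)
  ultimately obtain l r where l: "l \<in> sphere 0 1 \<times> R" and r: "strict_mono (r :: nat \<Rightarrow> nat)"
    and lim: "((\<lambda>n. (a n, z n)) \<circ> r) \<longlonglongrightarrow> l"
    by (rule seq_compactE)
  obtain a0 z0 where l0: "l = (a0, z0)" by (cases l)
  have a0: "norm a0 = 1" and z0: "z0 \<in> R" using l l0 by auto
  have a_lim: "(\<lambda>n. a (r n)) \<longlonglongrightarrow> a0" and z_lim: "(\<lambda>n. z (r n)) \<longlonglongrightarrow> z0"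
    using tendsto_fst[OF lim] tendsto_snd[OF lim] by (simp_all add: l0 o_def)
  define b0 where "b0 = a0 \<bullet> z0"
  have "b n = a n \<bullet> z n" for n using P[of n] by (simp add: P_def)
  then have b_lim: "(\<lambda>n. b (r n)) \<longlonglongrightarrow> b0"
    unfolding b0_def using tendsto_inner[OF a_lim z_lim] by simp
  \<comment> \<open>As \<open>z0\<close> lies in \<open>R\<close>, inside the open ball, the
    limiting hyperplane does not escape to infinity.\<close>
  have zH: "z0 \<in> hplane a0 b0" using z0 R(1) by (auto simp: b0_def)
  then have b0: "\<bar>b0\<bar> < 1" using hplane_offset_less_one[OF a0, of b0] by blast
  have xr_lim: "(\<lambda>n. x (r n)) \<longlonglongrightarrow> e"
    using LIMSEQ_subseq_LIMSEQ[OF x_lim r] by (simp add: o_def)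
  have h_lim: "(\<lambda>n. sinh_height (a (r n)) (b (r n)) (y n)) \<longlonglongrightarrow> sinh_height a0 b0 y0"
    if y: "y \<longlonglongrightarrow> y0" "y0 \<in> hyp_space" for y y0
  proof -
    have "sqrt (1 - b0\<^sup>2) * sqrt (1 - y0 \<bullet> y0) \<noteq> 0"
      using sinh_height_denominator_pos[OF a0 b0 y(2)] by (metis less_irrefl)
    then show ?thesis
      unfolding sinh_height_def by (intro tendsto_intros a_lim b_lim y(1))
  qed
  \<comment> \<open>A fixed point other than \<open>e\<close> eventually leaves the shrinking balls,
    so the strip inequalities hold there in the limit.\<close>
  have away: "a0 \<bullet> y \<le> b0 \<and> sinh_height a0 b0 y \<le> D" if y: "y \<in> R" "y \<noteq> e" for y
  proof -
    have yB: "y \<in> hyp_space" using y R by blast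
    have "\<forall>\<^sub>F n in sequentially. \<rho> n < dist e y"
      using order_tendstoD(2)[OF \<rho>_lim, of "dist e y"] y by simp
    then have "\<forall>\<^sub>F n in sequentially. \<rho> (r n) < dist e y"
      using eventually_subseq[OF r] by blast
    then have ev: "\<forall>\<^sub>F n in sequentially. a (r n) \<bullet> y \<le> b (r n) \<and>
        sinh_height (a (r n)) (b (r n)) y \<le> D"
    proof (rule eventually_mono)
      fix n assume "\<rho> (r n) < dist e y"
      then have "y \<in> R - ball e (\<rho> (r n))" using y by simp
      then show "a (r n) \<bullet> y \<le> b (r n) \<and> sinh_height (a (r n)) (b (r n)) y \<le> D"
        using P[of "r n"] unfolding P_def by blast
    qed
    have "a0 \<bullet> y \<le> b0"
      by (rule tendsto_le[OF _ b_lim tendsto_inner[OF a_lim tendsto_const]])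
        (use ev in \<open>auto elim: eventually_mono\<close>)
    moreover have "sinh_height a0 b0 y \<le> D"
      by (rule tendsto_upperbound[OF h_lim[OF tendsto_const yB]])
        (use ev in \<open>auto elim: eventually_mono\<close>)
    ultimately show ?thesis by blast
  qed
  have all: "a0 \<bullet> y \<le> b0 \<and> sinh_height a0 b0 y \<le> D" if y: "y \<in> R" for y
  proof (cases "y = e")
    case True
    \<comment> \<open>The point \<open>e\<close> is excluded from \<open>away\<close> and is
      approached along the segment towards \<open>q\<close>, with parameter
      \<open>1 / (2 * Suc n)\<close>.\<close>
    define w where "w = (\<lambda>n. e + (\<rho> n / (2 * \<epsilon>)) *\<^sub>R (q - e))"
    have w_lim: "w \<longlonglongrightarrow> e"
    proof -
      have "w \<longlonglongrightarrow> e + (0 / (2 * \<epsilon>)) *\<^sub>R (q - e)"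
        unfolding w_def using \<epsilon> by (intro tendsto_intros \<rho>_lim) auto
      then show ?thesis by simp
    qed
    have wR: "w n \<in> R" "w n \<noteq> e" for n
    proof -
      have "\<rho> n / (2 * \<epsilon>) \<le> 1" "\<rho> n / (2 * \<epsilon>) > 0"
        using \<epsilon> by (auto simp: \<rho>_def divide_simps)
      moreover have "w n = (1 - \<rho> n / (2 * \<epsilon>)) *\<^sub>R e + (\<rho> n / (2 * \<epsilon>)) *\<^sub>R q"
        by (simp add: w_def algebra_simps)
      ultimately show "w n \<in> R"
        using convexD[of R e q "1 - \<rho> n / (2 * \<epsilon>)" "\<rho> n / (2 * \<epsilon>)"] eR q(1) bR interior_subset[of R]
        by (auto simp: convex_body_def)
      show "w n \<noteq> e" using \<rho>_pos[of n] \<epsilon> q(2) by (simp add: w_def)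
    qed
    have "a0 \<bullet> e \<le> b0"
      by (rule tendsto_upperbound[OF tendsto_inner[OF tendsto_const w_lim]]) (use away wR in auto)
    moreover have "(\<lambda>n. sinh_height a0 b0 (w n)) \<longlonglongrightarrow> sinh_height a0 b0 e"
      by (rule continuous_on_tendsto_compose[OF continuous_on_sinh_height[OF a0 b0 R(1)] w_lim])
        (use wR eR in auto)
    then have "sinh_height a0 b0 e \<le> D"
      by (rule tendsto_upperbound) (use away wR in auto)
    ultimately show ?thesis using True by blast
  qed (use away y in blast)
  define H where "H = hplane a0 b0"
  have side: "R \<subseteq> hside a0 b0" using all R(1) by blast
  have sup: "supporting_hyperplane H R"
    unfolding supporting_hyperplane_iff H_def using a0 b0 side zH z0 by blast
  obtain c where c: "c \<in> R" "\<And>y. y \<in> R \<Longrightarrow> sinh_height a0 b0 y \<le> sinh_height a0 b0 c"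
    using obtain_farthest[OF bR a0 b0] by blast
  have w: "width H R = arsinh (sinh_height a0 b0 c)"
    unfolding H_def by (rule width_hplane[OF bR a0 b0 side c])
  \<comment> \<open>Containment of \<open>R\<close> in the limit strip bounds its width by
    \<open>arsinh D\<close>; the infimum defining the thickness gives the reverse bound.\<close>
  have "arsinh D \<le> arsinh (sinh_height a0 b0 c)"
    using thickness_le_width[OF bR sup] w D by simp
  then have cD: "sinh_height a0 b0 c = D"
    using all[OF c(1)] by (simp add: arsinh_le_iff_real)
  \<comment> \<open>If both inequalities were strict at \<open>e\<close>, they would hold strictly
    at \<open>x (r n)\<close> for large \<open>n\<close>, contradicting the violation recorded in
    \<open>P\<close>.\<close>
  have "b0 \<le> a0 \<bullet> e \<or> D \<le> sinh_height a0 b0 e"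
  proof (rule ccontr)
    assume "\<not> ?thesis"
    then have lt: "a0 \<bullet> e < b0" "sinh_height a0 b0 e < D" by auto
    have "\<forall>\<^sub>F n in sequentially. b (r n) - a (r n) \<bullet> x (r n) > 0"
      using order_tendstoD(1)[OF tendsto_diff[OF b_lim tendsto_inner[OF a_lim xr_lim]], of 0] lt by simp
    moreover have "\<forall>\<^sub>F n in sequentially. sinh_height (a (r n)) (b (r n)) (x (r n)) < D"
      using order_tendstoD(2)[OF h_lim[OF xr_lim eB] lt(2)] .
    ultimately have "\<forall>\<^sub>F n in sequentially. False"
    proof eventually_elim
      case (elim n)
      then show ?case using P[of "r n"] by (simp add: P_def)
    qed
    then show False by simp
  qed
  then have "e \<in> H \<or> sinh_height a0 b0 e = D"
    using all[OF eR] eB by (auto simp: H_def)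
  then have "e \<in> H \<or> e \<in> nearest_equidistant H R"
    using nearest_equidistant_hplane[OF bR a0 b0 side c] cD eB by (auto simp: H_def)
  moreover have "strip_thickness H (nearest_equidistant H R) = thickness R"
    using strip_thickness_nearest_equidistant[OF bR sup] w cD D by simp
  ultimately show ?thesis using sup by blast
qed

end
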